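(* (1) If $\ell$ is an odd prime and $a_1,a_2$ are integers with $0\leq a_1,a_2<\ell$ satisfying $\left(\frac{-16a_1+8a_2+1}{\ell}\right)=-1$, then $p_2(a_1,\ell;\ell n+a_2)=0$ for every non-negative integer $n$. (2) If $\ell\equiv 2\pmod 3$ is prime and $a_1,a_2$ are integers with $0\leq a_1,a_2<\ell^2$ such that $\mathrm{ord}_\ell(-9a_1+3a_2+1)=1$, then $p_3(a_1,\ell^2;\ell^2n+a_2)=0$ for every non-negative integer $n$.
   Context: For a partition $\lambda$, the node in row $k$ and column $j$ of its Ferrers–Young diagram has hook length $h(k,j)=(\lambda_k-k)+(\lambda'_j-j)+1$, where $\lambda'_j$ is the number of nodes in column $j$; $\mathcal{H}_t(\lambda)$ is the multiset of hook lengths of $\lambda$ divisible by $t$. Define $p_t(a,b;n):=\#\{\lambda\vdash n:\ \#\mathcal{H}_t(\lambda)\equiv a\pmod b\}$. $\left(\frac{\cdot}{\ell}\right)$ is the Legendre symbol and $\mathrm{ord}_\ell$ is the $\ell$-adic valuation. *)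

theory Defs
  imports "HOL-Library.Multiset" "HOL-Number_Theory.Number_Theory"
begin

text \<open>A partition of \<open>n\<close> is the weakly decreasing list of its positive parts.\<close>

definition is_partition_of :: "nat list \<Rightarrow> nat \<Rightarrow> bool" (infix \<open>\<turnstile>\<^sub>p\<close> 50)
  where "xs \<turnstile>\<^sub>p n \<longleftrightarrow> sorted_wrt (\<ge>) xs \<and> (\<forall>x\<in>set xs. 0 < x) \<and> sum_list xs = n"

text \<open>Rows and columns are numbered from 1, so row \<open>k\<close> has length \<open>xs ! (k - 1)\<close>.\<close>

definition diagram :: "nat list \<Rightarrow> (nat \<times> nat) set"
  where "diagram xs = {(k, j). 1 \<le> k \<and> k \<le> length xs \<and> 1 \<le> j \<and> j \<le> xs ! (k - 1)}"

definition col_len :: "nat list \<Rightarrow> nat \<Rightarrow> nat"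
  where "col_len xs j = card {k. (k, j) \<in> diagram xs}"

text \<open>The differences \<open>\<lambda>\<^sub>k - k\<close> and \<open>\<lambda>'\<^sub>j - j\<close> may be negative, hence the type \<^typ>\<open>int\<close>.\<close>

definition hook_length :: "nat list \<Rightarrow> nat \<Rightarrow> nat \<Rightarrow> int"
  where "hook_length xs k j =
    (int (xs ! (k - 1)) - int k) + (int (col_len xs j) - int j) + 1"

definition hook_multiset :: "nat \<Rightarrow> nat list \<Rightarrow> int multiset"
  where "hook_multiset t xs =
    {#h \<in># image_mset (\<lambda>(k, j). hook_length xs k j) (mset_set (diagram xs)). int t dvd h#}"

definition p_hooks :: "nat \<Rightarrow> nat \<Rightarrow> nat \<Rightarrow> nat \<Rightarrow> nat"
  where "p_hooks t a b n = card {xs. xs \<turnstile>\<^sub>p n \<and> [size (hook_multiset t xs) = a] (mod b)}"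

text \<open>
  Both \<^const>\<open>mset_set\<close> and \<^const>\<open>card\<close> are degenerate on infinite sets; the following
  facts show that this does not affect the definitions above.
\<close>

lemma finite_diagram: "finite (diagram xs)"
proof (rule finite_subset)
  show "diagram xs \<subseteq> {..length xs} \<times> {..sum_list xs}"
    by (auto simp: diagram_def intro: order_trans[OF _ elem_le_sum_list])
qed simp

lemma finite_column: "finite {k. (k, j) \<in> diagram xs}"
  by (rule finite_subset[of _ "{..length xs}"]) (auto simp: diagram_def)

lemma finite_partitions: "finite {xs. xs \<turnstile>\<^sub>p n}"
proof (rule finite_subset)
  have len: "\<forall>x\<in>set xs. 0 < x \<Longrightarrow> length xs \<le> sum_list xs" for xs :: "nat list"
    by (induction xs) auto
  show "{xs. xs \<turnstile>\<^sub>p n} \<subseteq> {xs. set xs \<subseteq> {..n} \<and> length xs \<le> n}"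
    by (auto simp: is_partition_of_def intro: len member_le_sum_list)
  show "finite {xs. set xs \<subseteq> {..n} \<and> length xs \<le> n}"
    by (rule finite_lists_length_le) simp
qed

end

theory Submission
  imports Defs
begin

text \<open>
  Encode a partition with parts \<open>\<lambda>\<^sub>1 \<ge> \<dots> \<ge> \<lambda>\<^sub>L\<close> by its bead set \<open>{\<lambda>\<^sub>k + L - k}\<close>. The hook lengths in
  row \<open>k\<close> are the differences between the bead of that row and the smaller non-beads, so the number
  \<open>m\<close> of hooks divisible by \<open>t\<close> can be read off from the beads in each residue class modulo \<open>t\<close>.
  Hence \<open>n - t m\<close> (the size of the \<open>t\<close>-core) depends only on the numbers \<open>c\<^sub>i\<close> of beads congruent
  to \<open>i\<close>. For \<open>t = 2\<close> it makes \<open>8 (n - 2 m) + 1\<close> a square; for \<open>t = 3\<close> it makes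
  \<open>3 (n - 3 m) + 1\<close> a value of the norm form \<open>u\<^sup>2 + u v + v\<^sup>2\<close>, and a prime \<open>\<ell> \<equiv> 2 (mod 3)\<close>,
  being inert, divides such a value only together with its square.
\<close>

section \<open>Hooks and beads\<close>

text \<open>For positive parts these are the hook lengths of the first column. The offset counts
  only the rows below, so prepending a row leaves the other beads fixed; the inductions below all
  add a new top row.\<close>

primrec beads :: "nat list \<Rightarrow> nat set" where
  "beads [] = {}"
| "beads (x # xs) = insert (x + length xs) (beads xs)"

definition bead_count :: "nat \<Rightarrow> nat list \<Rightarrow> nat \<Rightarrow> nat"
  where "bead_count t xs i = card {y \<in> beads xs. y mod t = i}"

lemma finite_beads [simp]: "finite (beads xs)"
  by (induction xs) auto

text \<open>Strict even for equal parts, because the offset drops by one from each row to the next.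
  Hence distinct rows have distinct beads.\<close>

lemma beads_less:
  assumes "sorted_wrt (\<ge>) (x # xs)"
  shows "beads xs \<subseteq> {..<x + length xs}"
  using assms by (induction xs arbitrary: x) (auto, fastforce)

lemma card_beads:
  assumes "sorted_wrt (\<ge>) xs"
  shows "card (beads xs) = length xs"
  using assms
proof (induction xs)
  case (Cons x xs)
  have "x + length xs \<notin> beads xs"
    using beads_less[OF Cons.prems] by auto
  then show ?case
    using Cons by simp
qed simp

lemma bead_count_Cons:
  assumes "sorted_wrt (\<ge>) (x # xs)"
  shows "bead_count t (x # xs) i =
    bead_count t xs i + (if (x + length xs) mod t = i then 1 else 0)"
proof -
  have "x + length xs \<notin> beads xs"
    using beads_less[OF assms] by auto
  moreover have "{y \<in> beads (x # xs). y mod t = i} =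
      (if (x + length xs) mod t = i then insert (x + length xs) {y \<in> beads xs. y mod t = i}
       else {y \<in> beads xs. y mod t = i})"
    by auto
  ultimately show ?thesis
    by (simp add: bead_count_def)
qed

section \<open>Columns of the diagram as gaps between beads\<close>

lemma diagram_Nil [simp]: "diagram [] = {}"
  by (auto simp: diagram_def)

lemma diagram_Cons:
  "diagram (x # xs) = Pair 1 ` {1..x} \<union> (\<lambda>(k, j). (Suc k, j)) ` diagram xs"
proof (intro equalityI subrelI)
  fix k j assume *: "(k, j) \<in> diagram (x # xs)"
  show "(k, j) \<in> Pair 1 ` {1..x} \<union> (\<lambda>(k, j). (Suc k, j)) ` diagram xs"
  proof (cases "k = 1")
    case True
    then show ?thesis using * by (auto simp: diagram_def)
  next
    case False
    then obtain k' where k: "k = Suc (Suc k')"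
      using * by (cases k; cases "k - 1") (auto simp: diagram_def)
    then have "(Suc k', j) \<in> diagram xs"
      using * by (auto simp: diagram_def)
    then show ?thesis using k by force
  qed
next
  fix k j assume "(k, j) \<in> Pair 1 ` {1..x} \<union> (\<lambda>(k, j). (Suc k, j)) ` diagram xs"
  then show "(k, j) \<in> diagram (x # xs)"
    by (auto simp: diagram_def nth_Cons split: nat.splits)
qed

lemma col_len_Nil [simp]: "col_len [] j = 0"
  by (simp add: col_len_def)

lemma col_len_Cons:
  assumes "1 \<le> j"
  shows "col_len (x # xs) j = (if j \<le> x then 1 else 0) + col_len xs j"
proof -
  let ?K = "{k. (k, j) \<in> diagram xs}"
  have "{k. (k, j) \<in> diagram (x # xs)} = (if j \<le> x then {1} else {}) \<union> Suc ` ?K"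
    using assms unfolding diagram_Cons by auto
  moreover have "1 \<notin> Suc ` ?K"
    by (auto simp: diagram_def)
  moreover have "card (Suc ` ?K) = card ?K"
    by (simp add: card_image)
  ultimately show ?thesis
    by (simp add: col_len_def finite_column)
qed

lemma col_len_le_length:
  assumes "1 \<le> j"
  shows "col_len xs j \<le> length xs"
  using assms by (induction xs) (simp_all add: col_len_Cons)

lemma col_len_antimono:
  assumes "1 \<le> i" "i \<le> j"
  shows "col_len xs j \<le> col_len xs i"
  using assms by (induction xs) (simp_all add: col_len_Cons)

lemma col_len_eq_0:
  assumes "1 \<le> j" "\<forall>x\<in>set xs. x < j"
  shows "col_len xs j = 0"
  using assms by (induction xs) (simp_all add: col_len_Cons)

text \<open>Read the rim of the diagram from the bottom left as a lattice path: vertical steps are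
  beads, horizontal steps are gaps. The number here is the position of the horizontal step that ends
  column \<open>j\<close>.\<close>

lemma column_not_bead:
  assumes "sorted_wrt (\<ge>) xs" "1 \<le> j"
  shows "length xs + j - 1 - col_len xs j \<notin> beads xs"
  using assms
proof (induction xs)
  case (Cons x xs)
  show ?case
  proof (cases "j \<le> x")
    \<comment> \<open>The new row lengthens both the list and the column by one, so the position is
      unchanged, and \<open>j \<le> x\<close> keeps it below the new bead. In the other case the
      column is empty and the position exceeds every bead.\<close>
    case True
    then show ?thesis
      using Cons col_len_le_length[of j xs] by (auto simp: col_len_Cons)
  next
    case False
    then have "col_len (x # xs) j = 0"
      using Cons.prems by (intro col_len_eq_0) auto
    then show ?thesis
      using False beads_less[OF Cons.prems(1)] by auto
  qed
qed simp

text \<open>No inverse is constructed: \<open>g\<close> increases strictly because column lengths do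
  not increase, it takes values in the gaps, and there are
  \<open>x + length xs - length xs = x\<close> gaps to fill.\<close>

lemma columns_eq_gaps:
  assumes "sorted_wrt (\<ge>) (x # xs)"
  defines "g \<equiv> \<lambda>j. length xs + j - 1 - col_len xs j"
  shows "bij_betw g {1..x} ({..<x + length xs} - beads xs)"
proof -
  have len: "col_len xs j \<le> length xs" if "1 \<le> j" for j
    using that by (rule col_len_le_length)
  have "strict_mono_on {1..x} g"
  proof (rule strict_mono_onI)
    fix i j assume "i \<in> {1..x}" "j \<in> {1..x}" "i < j"
    then show "g i < g j"
      using len[of i] len[of j] col_len_antimono[of i j xs] by (auto simp: g_def)
  qed
  then have inj: "inj_on g {1..x}"
    by (rule strict_mono_on_imp_inj_on)
  have "g ` {1..x} = {..<x + length xs} - beads xs"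
  proof (rule card_subset_eq)
    show "g ` {1..x} \<subseteq> {..<x + length xs} - beads xs"
    proof
      fix y assume "y \<in> g ` {1..x}"
      then obtain j where j: "1 \<le> j" "j \<le> x" "y = g j"
        by auto
      then show "y \<in> {..<x + length xs} - beads xs"
        using assms(1) column_not_bead[of xs j] by (auto simp: g_def)
    qed
    have "card ({..<x + length xs} - beads xs) = x"
      using beads_less[OF assms(1)] card_beads[of xs] assms(1)
      by (subst card_Diff_subset) auto
    then show "card (g ` {1..x}) = card ({..<x + length xs} - beads xs)"
      using card_image[OF inj] by simp
  qed simp
  then show ?thesis
    using inj by (simp add: bij_betw_def)
qed

section \<open>Hooks divisible by \<open>t\<close>, one row at a time\<close>

lemma card_less_same_residue:
  fixes b t :: nat
  assumes "0 < t"
  shows "card {g. g < b \<and> g mod t = b mod t} = b div t"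
proof -
  have "{g. g < b \<and> g mod t = b mod t} = (\<lambda>q. q * t + b mod t) ` {..<b div t}"
  proof (intro equalityI subsetI)
    fix g assume g: "g \<in> {g. g < b \<and> g mod t = b mod t}"
    then have eq: "g = g div t * t + b mod t"
      by (metis (mono_tags, lifting) div_mult_mod_eq mem_Collect_eq)
    have "g div t * t < b div t * t"
      using g eq div_mult_mod_eq[of b t] by (metis (no_types, lifting) add_less_cancel_right mem_Collect_eq)
    then have "g div t < b div t"
      using assms by simp
    then show "g \<in> (\<lambda>q. q * t + b mod t) ` {..<b div t}"
      using eq by blast
  next
    fix g assume "g \<in> (\<lambda>q. q * t + b mod t) ` {..<b div t}"
    then obtain q where q: "q < b div t" "g = q * t + b mod t"
      by auto
    then have "q * t < b div t * t"
      using assms by simp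
    then have "g < b"
      using q div_mult_mod_eq[of b t] by linarith
    then show "g \<in> {g. g < b \<and> g mod t = b mod t}"
      using q by simp
  qed
  moreover have "inj_on (\<lambda>q. q * t + b mod t) {..<b div t}"
    using assms by (auto simp: inj_on_def)
  ultimately show ?thesis
    by (simp add: card_image)
qed

lemma size_hook_multiset:
  "size (hook_multiset t xs) =
    card {p \<in> diagram xs. int t dvd (\<lambda>(k, j). hook_length xs k j) p}"
  by (simp add: hook_multiset_def filter_mset_image_mset finite_diagram)

text \<open>The row index grows by one, and so does the column, since by sortedness the new top row
  reaches column \<open>j\<close>; the two changes cancel.\<close>

lemma hook_length_Suc_Cons:
  assumes "sorted_wrt (\<ge>) (x # xs)" "(k, j) \<in> diagram xs"
  shows "hook_length (x # xs) (Suc k) j = hook_length xs k j"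
proof -
  have k: "1 \<le> k" "k \<le> length xs" "1 \<le> j" "j \<le> xs ! (k - 1)"
    using assms(2) by (auto simp: diagram_def)
  then have "xs ! (k - 1) \<le> x"
    using assms(1) by auto
  with k show ?thesis
    by (cases k) (auto simp: hook_length_def col_len_Cons)
qed

lemma hook_length_1_Cons:
  assumes "1 \<le> j" "j \<le> x"
  shows "hook_length (x # xs) 1 j =
    int (x + length xs) - int (length xs + j - 1 - col_len xs j)"
  using assms col_len_le_length[of j xs]
  by (simp add: hook_length_def col_len_Cons)

text \<open>Hooks in the new row are \<open>b\<close> minus a gap, so those divisible by
  \<open>t\<close> correspond to the gaps below \<open>b\<close> in its residue class:
  \<open>b div t\<close> positions less the beads among them. The additive form avoids truncated
  subtraction.\<close>

lemma size_hook_multiset_Cons: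
  assumes "sorted_wrt (\<ge>) (x # xs)" "0 < t"
  defines "b \<equiv> x + length xs"
  shows "size (hook_multiset t (x # xs)) + bead_count t xs (b mod t) =
    size (hook_multiset t xs) + b div t"
proof -
  let ?H = "\<lambda>xs. {p \<in> diagram xs. int t dvd (\<lambda>(k, j). hook_length xs k j) p}"
  let ?R = "{j \<in> {1..x}. int t dvd hook_length (x # xs) 1 j}"
  let ?g = "\<lambda>j. length xs + j - 1 - col_len xs j"
  let ?G = "{g \<in> {..<b} - beads xs. g mod t = b mod t}"
  have dvd_iff: "int t dvd int b - int g \<longleftrightarrow> g mod t = b mod t" for g
    by (metis mod_eq_dvd_iff of_nat_eq_iff zmod_int)
  have "?H (x # xs) = Pair 1 ` ?R \<union> (\<lambda>(k, j). (Suc k, j)) ` ?H xs"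
    unfolding diagram_Cons using hook_length_Suc_Cons[OF assms(1)] by force
  moreover have "Pair 1 ` ?R \<inter> (\<lambda>(k, j). (Suc k, j)) ` ?H xs = {}"
    by (auto simp: diagram_def)
  moreover have "card (Pair (1::nat) ` ?R) = card ?R"
    by (intro card_image) (auto simp: inj_on_def)
  moreover have "card ((\<lambda>(k, j). (Suc k, j)) ` ?H xs) = card (?H xs)"
    by (intro card_image) (auto simp: inj_on_def)
  moreover have "finite (?H xs)"
    using finite_diagram by simp
  ultimately have H: "card (?H (x # xs)) = card ?R + card (?H xs)"
    by (simp add: card_Un_disjoint)
  have bij: "bij_betw ?g {1..x} ({..<b} - beads xs)"
    unfolding b_def by (rule columns_eq_gaps) fact
  have R: "?R = {j \<in> {1..x}. ?g j mod t = b mod t}"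
    using hook_length_1_Cons[of _ x xs] dvd_iff by (auto simp: b_def)
  have "?g ` ?R = ?G"
    unfolding R bij_betw_imp_surj_on[OF bij, symmetric] by auto
  moreover have "inj_on ?g ?R"
    by (rule inj_on_subset[OF bij_betw_imp_inj_on[OF bij]]) auto
  ultimately have "card ?R = card ?G"
    using card_image by fastforce
  \<comment> \<open>\<open>bead_count\<close> has no upper bound, but all old beads lie below
    \<open>b\<close>.\<close>
  moreover have "{g. g < b \<and> g mod t = b mod t} = ?G \<union> {y \<in> beads xs. y mod t = b mod t}"
    using beads_less[OF assms(1)] by (auto simp: b_def)
  then have "b div t = card ?G + bead_count t xs (b mod t)"
    unfolding bead_count_def card_less_same_residue[OF assms(2), symmetric]
    by (simp add: card_Un_disjoint disjoint_iff)
  ultimately show ?thesis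
    using H by (simp add: size_hook_multiset)
qed

section \<open>The size of the \<open>t\<close>-core in terms of bead counts\<close>

definition core_size :: "nat \<Rightarrow> nat list \<Rightarrow> int"
  where "core_size t xs = int (sum_list xs) - int t * int (size (hook_multiset t xs))"

lemma core_size_Nil [simp]: "core_size t [] = 0"
  by (simp add: core_size_def size_hook_multiset)

text \<open>Writing \<open>x + length xs\<close> as \<open>t\<close> times its quotient plus
  \<open>r\<close>, the quotient cancels against the new hooks, leaving only the residue and bead
  counts.\<close>

lemma core_size_Cons:
  assumes "sorted_wrt (\<ge>) (x # xs)" "0 < t"
  defines "r \<equiv> (x + length xs) mod t"
  shows "core_size t (x # xs) =
    core_size t xs + int r - int (length xs) + int t * int (bead_count t xs r)"
proof -
  let ?b = "x + length xs"
  have "int (size (hook_multiset t (x # xs))) =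
      int (size (hook_multiset t xs)) + int (?b div t) - int (bead_count t xs r)"
    using size_hook_multiset_Cons[OF assms(1,2)] unfolding r_def by linarith
  then have "int t * int (size (hook_multiset t (x # xs))) =
      int t * int (size (hook_multiset t xs)) + int t * int (?b div t) -
      int t * int (bead_count t xs r)"
    by (simp only: right_diff_distrib distrib_left)
  moreover have "int x + int (length xs) = int t * int (?b div t) + int r"
    unfolding r_def by (metis mult_div_mod_eq of_nat_add of_nat_mult)
  ultimately show ?thesis
    unfolding core_size_def sum_list.Cons of_nat_add by linarith
qed

lemma bead_count_Nil [simp]: "bead_count t [] i = 0"
  by (simp add: bead_count_def)

lemma length_eq_sum_bead_count:
  assumes "sorted_wrt (\<ge>) xs" "0 < t"
  shows "length xs = (\<Sum>i<t. bead_count t xs i)"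
  using assms(1)
proof (induction xs)
  case (Cons x xs)
  then show ?case
    using assms(2) by (simp add: bead_count_Cons sum.distrib)
qed simp

text \<open>With \<open>d = c xs 0 - c xs 1\<close> this is the triangular number
  \<open>d * (d - 1) / 2\<close>, the size of a staircase. A new bead moves \<open>d\<close> by 1 up
  or down.\<close>

lemma core_size_2:
  assumes "sorted_wrt (\<ge>) xs"
  defines "c \<equiv> \<lambda>xs i. int (bead_count 2 xs i)"
  shows "8 * core_size 2 xs + 1 = (2 * (c xs 0 - c xs 1) - 1)\<^sup>2"
  using assms(1)
proof (induction xs)
  case (Cons x xs)
  define r where "r = (x + length xs) mod 2"
  have "int (length xs) = c xs 0 + c xs 1"
    using length_eq_sum_bead_count[of xs 2] Cons.prems by (simp add: c_def eval_nat_numeral)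
  then have core: "core_size 2 (x # xs) = core_size 2 xs + int r - (c xs 0 + c xs 1) + 2 * c xs r"
    using core_size_Cons[OF Cons.prems, of 2] by (simp add: c_def r_def)
  have count: "c (x # xs) i = c xs i + (if r = i then 1 else 0)" for i
    using Cons.prems by (simp add: c_def r_def bead_count_Cons)
  have IH: "8 * core_size 2 xs + 1 = (2 * (c xs 0 - c xs 1) - 1)\<^sup>2"
    using Cons by simp
  have r: "r = 0 \<or> r = 1"
    unfolding r_def by linarith
  have "8 * core_size 2 (x # xs) + 1 =
      (8 * core_size 2 xs + 1) + 8 * (int r - (c xs 0 + c xs 1) + 2 * c xs r)"
    by (simp only: core) (simp only: algebra_simps)
  also have "\<dots> = (2 * (c (x # xs) 0 - c (x # xs) 1) - 1)\<^sup>2"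
    unfolding IH count using r
    by (elim disjE) (simp_all add: power2_eq_square algebra_simps)
  finally show ?case .
qed (simp add: c_def)

text \<open>A new bead in class 0, 1 or 2 shifts \<open>(u, v)\<close> by \<open>(1, 1)\<close>,
  \<open>(1, -2)\<close> or \<open>(-2, 1)\<close>. These shifts sum to zero, as one bead in each
  class must not change the core. The \<open>- 1\<close> in \<open>u\<close> gives the empty
  partition the norm 1.\<close>

lemma core_size_3:
  assumes "sorted_wrt (\<ge>) xs"
  defines "c \<equiv> \<lambda>xs i. int (bead_count 3 xs i)"
  defines "u \<equiv> \<lambda>xs. c xs 0 + c xs 1 - 2 * c xs 2 - 1"
    and "v \<equiv> \<lambda>xs. c xs 0 - 2 * c xs 1 + c xs 2"
  shows "3 * core_size 3 xs + 1 = (u xs)\<^sup>2 + u xs * v xs + (v xs)\<^sup>2"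
  using assms(1)
proof (induction xs)
  case (Cons x xs)
  define r where "r = (x + length xs) mod 3"
  have "int (length xs) = c xs 0 + c xs 1 + c xs 2"
    using length_eq_sum_bead_count[of xs 3] Cons.prems by (simp add: c_def eval_nat_numeral)
  then have core: "core_size 3 (x # xs) =
      core_size 3 xs + int r - (c xs 0 + c xs 1 + c xs 2) + 3 * c xs r"
    using core_size_Cons[OF Cons.prems, of 3] by (simp add: c_def r_def)
  have count: "c (x # xs) i = c xs i + (if r = i then 1 else 0)" for i
    using Cons.prems by (simp add: c_def r_def bead_count_Cons)
  have IH: "3 * core_size 3 xs + 1 = (u xs)\<^sup>2 + u xs * v xs + (v xs)\<^sup>2"
    using Cons by simp
  have r: "r = 0 \<or> r = 1 \<or> r = 2"
    unfolding r_def by linarith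
  have "3 * core_size 3 (x # xs) + 1 =
      (3 * core_size 3 xs + 1) + 3 * (int r - (c xs 0 + c xs 1 + c xs 2) + 3 * c xs r)"
    by (simp only: core) (simp only: algebra_simps)
  also have "\<dots> = (u (x # xs))\<^sup>2 + u (x # xs) * v (x # xs) + (v (x # xs))\<^sup>2"
    unfolding IH u_def v_def count using r
    by (elim disjE) (simp_all add: power2_eq_square algebra_simps)
  finally show ?case .
qed (simp add: u_def v_def c_def)

section \<open>The norm form at inert primes\<close>

text \<open>Since 3 is coprime to \<open>l - 1\<close>, cubing is injective on units: with
  \<open>l - 1 = 3 * k + 1\<close>, Fermat makes \<open>(w ^ 3) ^ k\<close> the inverse of
  \<open>w\<close>, so the cube determines \<open>w\<close>.\<close>

lemma cube_cong_imp_cong: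
  fixes u v :: int and l :: nat
  assumes "prime l" "[l = 2] (mod 3)" "\<not> int l dvd u" "\<not> int l dvd v"
    and "[u ^ 3 = v ^ 3] (mod int l)"
  shows "[u = v] (mod int l)"
proof -
  have "l mod 3 = 2"
    using assms(2) by (simp add: cong_def)
  then obtain k where k: "l = 3 * k + 2"
    by (metis mult_div_mod_eq)
  have fermat: "[w * w ^ (3 * k) = 1] (mod int l)" if "\<not> int l dvd w" for w
  proof -
    \<comment> \<open>\<open>fermat_theorem\<close> concerns naturals, so the integer
      \<open>w\<close> is replaced by its least nonnegative residue.\<close>
    define a where "a = nat (w mod int l)"
    have a: "[int a = w] (mod int l)"
      using assms(1) by (simp add: a_def cong_def prime_gt_0_nat)
    then have "\<not> l dvd a"
      using that by (metis cong_dvd_iff int_dvd_int_iff)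
    then have "[a ^ (l - 1) = 1] (mod l)"
      using assms(1) by (rule fermat_theorem[rotated])
    then have "[int a ^ (l - 1) = 1] (mod int l)"
      by (metis cong_int_iff of_nat_1 of_nat_power)
    then have "[w ^ (l - 1) = 1] (mod int l)"
      using cong_pow[OF a, of "l - 1"] by (meson cong_sym cong_trans)
    then show ?thesis
      by (simp add: k)
  qed
  have "[u ^ (3 * k) = v ^ (3 * k)] (mod int l)"
    using cong_pow[OF assms(5), of k] by (simp add: power_mult)
  then have "[u * u ^ (3 * k) = u * v ^ (3 * k)] (mod int l)"
    by (rule cong_scalar_left)
  then have "[u * v ^ (3 * k) = v * v ^ (3 * k)] (mod int l)"
    using fermat[OF assms(3)] fermat[OF assms(4)] by (meson cong_sym cong_trans)
  moreover have "coprime (v ^ (3 * k)) (int l)"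
    using assms(1,4) by (metis coprime_commute coprime_power_right_iff prime_imp_coprime prime_nat_int_transfer)
  ultimately show ?thesis
    by (simp add: cong_mult_rcancel)
qed

text \<open>The prime must divide both \<open>u\<close> and \<open>v\<close>, and then its square
  divides each term.\<close>

lemma inert_prime_square_dvd_norm:
  fixes u v :: int and l :: nat
  assumes "prime l" "[l = 2] (mod 3)" "int l dvd u\<^sup>2 + u * v + v\<^sup>2"
  shows "(int l)\<^sup>2 dvd u\<^sup>2 + u * v + v\<^sup>2"
proof -
  have p: "prime (int l)"
    using assms(1) by simp
  have "int l dvd u \<and> int l dvd v"
  proof (cases "int l dvd u \<or> int l dvd v")
    case True
    then show ?thesis
    proof
      assume "int l dvd u"
      then have "int l dvd u\<^sup>2 + u * v"
        by (simp add: power2_eq_square)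
      then have "int l dvd v\<^sup>2"
        using assms(3) dvd_add_right_iff by blast
      with \<open>int l dvd u\<close> p show ?thesis
        using prime_dvd_power by blast
    next
      assume "int l dvd v"
      then have "int l dvd u * v + v\<^sup>2"
        by (simp add: power2_eq_square)
      then have "int l dvd u\<^sup>2"
        using assms(3) by (metis add.assoc dvd_add_left_iff)
      with \<open>int l dvd v\<close> p show ?thesis
        using prime_dvd_power by blast
    qed
  next
    case False
    \<comment> \<open>If \<open>l\<close> divides neither, this factorization and injectivity of
      cubing give \<open>u\<close> congruent to \<open>v\<close>. The form then reduces to
      \<open>3 * v\<^sup>2\<close>, forcing \<open>l = 3\<close>, which is not 2 modulo 3.\<close>
    have "u ^ 3 - v ^ 3 = (u - v) * (u\<^sup>2 + u * v + v\<^sup>2)"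
      by (simp add: power2_eq_square power3_eq_cube algebra_simps)
    then have "[u ^ 3 = v ^ 3] (mod int l)"
      using assms(3) by (simp add: cong_iff_dvd_diff)
    then have "[u = v] (mod int l)"
      using cube_cong_imp_cong assms(1,2) False by blast
    then have "int l dvd u - v"
      by (simp add: cong_iff_dvd_diff)
    moreover have "u\<^sup>2 + u * v + v\<^sup>2 = (u - v) * (u + 2 * v) + 3 * v\<^sup>2"
      by (simp add: power2_eq_square algebra_simps)
    ultimately have "int l dvd 3 * v\<^sup>2"
      using assms(3) by (metis dvd_add_right_iff dvd_mult2)
    then have "int l dvd 3"
      using p False by (metis prime_dvd_mult_iff prime_dvd_power)
    then have "l dvd 3"
      by (metis int_dvd_int_iff of_nat_numeral)
    then have "l = 3"
      using assms(1) by (simp add: primes_dvd_imp_eq)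
    then show ?thesis
      using assms(2) by (simp add: cong_def)
  qed
  then show ?thesis
    by (simp add: power2_eq_square mult_dvd_mono)
qed

section \<open>The vanishing of the partition counts\<close>

lemma core_size_cong:
  assumes "xs \<turnstile>\<^sub>p b * n + a2" "[size (hook_multiset t xs) = a1] (mod b)"
  shows "[core_size t xs = int a2 - int t * int a1] (mod int b)"
proof -
  have "[int (size (hook_multiset t xs)) = int a1] (mod int b)"
    using assms(2) by (simp add: cong_int_iff)
  moreover have "[int (b * n + a2) = int a2] (mod int b)"
    by (simp add: cong_def)
  ultimately show ?thesis
    using assms(1) unfolding core_size_def is_partition_of_def
    by (metis cong_diff cong_scalar_left)
qed

lemma p_hooks_eq_0:
  assumes "\<And>xs. xs \<turnstile>\<^sub>p n \<Longrightarrow> [size (hook_multiset t xs) = a] (mod b) \<Longrightarrow> False"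
  shows "p_hooks t a b n = 0"
proof -
  have "{xs. xs \<turnstile>\<^sub>p n \<and> [size (hook_multiset t xs) = a] (mod b)} = {}"
    using assms by blast
  then show ?thesis
    by (simp only: p_hooks_def card.empty)
qed

text \<open>A partition counted here would make the Legendre argument congruent to the square in
  \<open>core_size_2\<close>, hence not a nonresidue.\<close>

lemma p_hooks_2_eq_0:
  assumes "Legendre (- 16 * int a1 + 8 * int a2 + 1) (int l) = - 1"
  shows "p_hooks 2 a1 l (l * n + a2) = 0"
proof (rule p_hooks_eq_0)
  fix xs assume *: "xs \<turnstile>\<^sub>p l * n + a2" "[size (hook_multiset 2 xs) = a1] (mod l)"
  define s where "s = 2 * (int (bead_count 2 xs 0) - int (bead_count 2 xs 1)) - 1"
  have "[8 * core_size 2 xs + 1 = 8 * (int a2 - int 2 * int a1) + 1] (mod int l)"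
    by (intro cong_add cong_scalar_left core_size_cong[OF *] cong_refl)
  moreover have "8 * core_size 2 xs + 1 = s\<^sup>2"
    using core_size_2 * by (simp add: s_def is_partition_of_def)
  ultimately have "[s\<^sup>2 = - 16 * int a1 + 8 * int a2 + 1] (mod int l)"
    by (simp add: algebra_simps)
  then have "QuadRes (int l) (- 16 * int a1 + 8 * int a2 + 1)"
    unfolding QuadRes_def by blast
  then show False
    using assms by (auto simp: Legendre_def split: if_splits)
qed

text \<open>The modulus \<open>l\<^sup>2\<close> carries divisibility both ways: \<open>l\<close>
  passes from \<open>D\<close> to the norm \<open>N\<close>, inertness improves it to
  \<open>l\<^sup>2\<close>, and this returns to \<open>D\<close>, against valuation 1.\<close>

lemma p_hooks_3_eq_0:
  assumes "prime l" "[l = 2] (mod 3)"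
    and "multiplicity (int l) (- 9 * int a1 + 3 * int a2 + 1) = 1"
  shows "p_hooks 3 a1 (l\<^sup>2) (l\<^sup>2 * n + a2) = 0"
proof (rule p_hooks_eq_0)
  fix xs assume *: "xs \<turnstile>\<^sub>p l\<^sup>2 * n + a2" "[size (hook_multiset 3 xs) = a1] (mod l\<^sup>2)"
  define D where "D = - 9 * int a1 + 3 * int a2 + 1"
  define N where "N = 3 * core_size 3 xs + 1"
  have "[N = 3 * (int a2 - int 3 * int a1) + 1] (mod int (l\<^sup>2))"
    unfolding N_def by (intro cong_add cong_scalar_left core_size_cong[OF *] cong_refl)
  then have cong: "[N = D] (mod (int l)\<^sup>2)"
    by (simp add: D_def algebra_simps)
  have "int l dvd D"
    using assms(3) multiplicity_dvd[of "int l" D] by (simp add: D_def)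
  moreover have "[N = D] (mod int l)"
    using cong by (rule cong_dvd_modulus) simp
  ultimately have "int l dvd N"
    by (simp add: cong_dvd_iff)
  moreover obtain u v where "N = u\<^sup>2 + u * v + v\<^sup>2"
    using core_size_3 * unfolding N_def is_partition_of_def by blast
  ultimately have "(int l)\<^sup>2 dvd N"
    using inert_prime_square_dvd_norm assms(1,2) by blast
  then have "(int l)\<^sup>2 dvd D"
    using cong by (simp add: cong_dvd_iff)
  \<comment> \<open>By convention \<open>multiplicity\<close> of zero is 0, so the value 1 excludes
    \<open>D = 0\<close>.\<close>
  moreover have "D \<noteq> 0"
    using assms(3) by (auto simp: D_def)
  moreover have "\<not> is_unit (int l)"
    using assms(1) by (auto simp: not_prime_1)
  ultimately have "2 \<le> multiplicity (int l) D"
    by (intro multiplicity_geI) auto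
  then show False
    using assms(3) by (simp add: D_def)
qed

theorem theorem1p5:
  shows "(\<forall>l a1 a2 :: nat.
            prime l \<and> odd l \<and> a1 < l \<and> a2 < l \<and>
            Legendre (- 16 * int a1 + 8 * int a2 + 1) (int l) = - 1 \<longrightarrow>
            (\<forall>n. p_hooks 2 a1 l (l * n + a2) = 0)) \<and>
         (\<forall>l a1 a2 :: nat.
            prime l \<and> [l = 2] (mod 3) \<and> a1 < l\<^sup>2 \<and> a2 < l\<^sup>2 \<and>
            multiplicity (int l) (- 9 * int a1 + 3 * int a2 + 1) = 1 \<longrightarrow>
            (\<forall>n. p_hooks 3 a1 (l\<^sup>2) (l\<^sup>2 * n + a2) = 0))"
  using p_hooks_2_eq_0 p_hooks_3_eq_0 by blast

end
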